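(* Let $(X,\mathcal{M},\mu)$ be a measure space with non-trivial sigma-finite measure $\mu$, $\mu(X)=\infty$, and let $f:X\to\mathbb{R}$ be a measurable function that is not $\mu$-almost everywhere zero. Let $0<a<b\le\infty$ and suppose that $$p\int_0^\infty t^{p-1}\,T[f](t)\,dt<\infty\qquad\text{for all } p\in(a,b).$$ Then the natural generating function $\psi[f](p):=\|f\|_p$, $p\in(a,b)$, of $f$ has the form $$\psi[f](p)=\left[p\int_0^\infty t^{p-1}\,T[f](t)\,dt\right]^{1/p},\qquad p\in(a,b),$$ and $f\in G\psi[f]$ with $\|f\|_{G\psi[f]}=1$.
   Context: For measurable $f:X\to\mathbb{R}$ and $0<p<\infty$, $\|f\|_p:=\left[\int_X|f(x)|^p\,\mu(dx)\right]^{1/p}$. The tail function of $f$ is $T[f](t):=\mu\{x\in X:\ |f(x)|>t\}$, $t>0$. For a function $\psi:(a,b)\to(0,\infty)$ (a generating function, with $\inf_{p\in(a,b)}\psi(p)>0$), the Grand Lebesgue Space norm is $\|f\|_{G\psi}:=\sup_{p\in(a,b)}\frac{\|f\|_p}{\psi(p)}$, and $G\psi=\{f:\ \|f\|_{G\psi}<\infty\}$. In this statement the same definition is used for intervals $(a,b)$ with $0<a<b\le\infty$. *)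

theory Defs
  imports "HOL-Analysis.Analysis"
begin

(* Power with positive real exponent on [0,\<infinity>], with \<infinity> to the power r equal to \<infinity>;
   only used for r > 0. *)
definition ennreal_powr :: "ennreal \<Rightarrow> real \<Rightarrow> ennreal" where
  "ennreal_powr x r = (if x = \<infinity> then \<infinity> else ennreal (enn2real x powr r))"

(* Takes the value \<infinity> if f is not p-integrable; meant for 0 < p < \<infinity>. *)
definition lp_norm :: "'a measure \<Rightarrow> real \<Rightarrow> ('a \<Rightarrow> real) \<Rightarrow> ennreal" where
  "lp_norm M p f = ennreal_powr (\<integral>\<^sup>+ x. ennreal (\<bar>f x\<bar> powr p) \<partial>M) (1 / p)"

definition tail_function :: "'a measure \<Rightarrow> ('a \<Rightarrow> real) \<Rightarrow> real \<Rightarrow> ennreal" where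
  "tail_function M f t = emeasure M {x \<in> space M. \<bar>f x\<bar> > t}"

definition tail_moment :: "'a measure \<Rightarrow> ('a \<Rightarrow> real) \<Rightarrow> real \<Rightarrow> ennreal" where
  "tail_moment M f p =
     ennreal p * (\<integral>\<^sup>+ t\<in>{0<..}. ennreal (t powr (p - 1)) * tail_function M f t \<partial>lborel)"

(* A generating function (a,b) \<rightarrow> (0,\<infinity>) is represented by a function into [0,\<infinity>] whose
   restriction to (a,b) has its values in (0,\<infinity>); its values outside (a,b) are irrelevant. *)
definition generating_function :: "ereal \<Rightarrow> ereal \<Rightarrow> (real \<Rightarrow> ennreal) \<Rightarrow> bool" where
  "generating_function a b \<psi> \<longleftrightarrow>
     (\<forall>p\<in>einterval a b. 0 < \<psi> p \<and> \<psi> p < \<infinity>) \<and> 0 < (INF p\<in>einterval a b. \<psi> p)"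

definition gls_norm ::
    "'a measure \<Rightarrow> ereal \<Rightarrow> ereal \<Rightarrow> (real \<Rightarrow> ennreal) \<Rightarrow> ('a \<Rightarrow> real) \<Rightarrow> ennreal" where
  "gls_norm M a b \<psi> f = (SUP p\<in>einterval a b. lp_norm M p f / \<psi> p)"

definition gls_space ::
    "'a measure \<Rightarrow> ereal \<Rightarrow> ereal \<Rightarrow> (real \<Rightarrow> ennreal) \<Rightarrow> ('a \<Rightarrow> real) set" where
  "gls_space M a b \<psi> = {f \<in> borel_measurable M. gls_norm M a b \<psi> f < \<infinity>}"

definition natural_generating_function :: "'a measure \<Rightarrow> ('a \<Rightarrow> real) \<Rightarrow> real \<Rightarrow> ennreal" where
  "natural_generating_function M f p = lp_norm M p f"

end

theory Submission
  imports Defs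
begin

text \<open>
  By Tonelli and \<open>c powr p = p * \<integral>\<^sub>0\<^sup>c t powr (p - 1) dt\<close>, the \<open>p\<close>-th absolute moment of \<open>f\<close> is its
  tail moment, so the quotients defining the norm are all 1. The infimum of the natural generating
  function is positive because \<open>a > 0\<close>: if \<open>\<bar>f\<bar> > t\<close> on a set of measure at least
  \<open>m \<in> (0, 1]\<close>, then its values are at least \<open>t * m powr (1 / p) \<ge> t * m powr (1 / a)\<close>.
\<close>

lemma ennreal_powr_ennreal:
  assumes "0 \<le> x"
  shows "ennreal_powr (ennreal x) r = ennreal (x powr r)"
  using assms by (simp add: ennreal_powr_def)

lemma ennreal_powr_less_top:
  assumes "x < \<infinity>"
  shows "ennreal_powr x r < \<infinity>"
  using assms by (simp add: ennreal_powr_def)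

lemma ennreal_powr_mono:
  assumes "x \<le> y" and "0 \<le> r"
  shows "ennreal_powr x r \<le> ennreal_powr y r"
\<comment> \<open>\<open>enn2real\<close> sends infinity to 0, so it is monotone only between finite
  values; for infinite \<open>y\<close> the bound is trivial.\<close>
proof (cases "y = \<infinity>")
  case False
  then have "y < top"
    by (simp add: less_top)
  then have "x < top"
    using assms(1) by (rule order.strict_trans1[rotated])
  with \<open>y < top\<close> show ?thesis
    using assms by (auto simp: ennreal_powr_def intro!: ennreal_leI powr_mono2 enn2real_mono)
qed (simp add: ennreal_powr_def)

lemma nn_integral_powr_from_0:
  fixes c p :: real
  assumes "0 < p" and "0 \<le> c"
  shows "(\<integral>\<^sup>+ t\<in>{0..c}. ennreal (t powr (p - 1)) \<partial>lborel) = ennreal (c powr p / p)"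
proof -
  \<comment> \<open>For \<open>p < 1\<close> the integrand is unbounded near 0, but
    \<open>p - 1 > -1\<close> keeps it integrable.\<close>
  have "((\<lambda>t. t powr (p - 1)) has_integral (c powr p / p)) {0..c}"
    using has_integral_powr_from_0[of "p - 1" c] assms by simp
  then show ?thesis
    by (intro nn_integral_has_integral_lebesgue') auto
qed

lemma nn_integral_powr_eq_tail_moment:
  assumes "sigma_finite_measure M" and [measurable]: "f \<in> borel_measurable M" and "0 < p"
  shows "(\<integral>\<^sup>+ x. ennreal (\<bar>f x\<bar> powr p) \<partial>M) = tail_moment M f p"
proof -
  interpret M: sigma_finite_measure M
    by fact
  interpret pair_sigma_finite lborel M
    by unfold_locales
  \<comment> \<open>The kernel lives on the region under the graph of \<open>\<bar>f\<bar>\<close>.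
    Integrating over \<open>x\<close> first produces the tail function, integrating over
    \<open>t\<close> first produces \<open>\<bar>f x\<bar> powr p / p\<close>; Tonelli equates the
    two.\<close>
  define h where
    "h t x = ennreal (t powr (p - 1)) * indicator {(t, x). 0 < t \<and> t < \<bar>f x\<bar>} (t, x)"
    for t x
  have [measurable]: "case_prod h \<in> borel_measurable (lborel \<Otimes>\<^sub>M M)"
    unfolding h_def by measurable
  have tail: "ennreal (t powr (p - 1)) * tail_function M f t * indicator {0<..} t
      = (\<integral>\<^sup>+ x. h t x \<partial>M)" for t
  proof -
    have "(\<integral>\<^sup>+ x. h t x \<partial>M) = (\<integral>\<^sup>+ x. ennreal (t powr (p - 1)) * indicator {0<..} t *
        indicator {x \<in> space M. \<bar>f x\<bar> > t} x \<partial>M)"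
      unfolding h_def by (intro nn_integral_cong) (auto simp: indicator_def)
    also have "\<dots> = ennreal (t powr (p - 1)) * indicator {0<..} t * tail_function M f t"
      unfolding tail_function_def by (subst nn_integral_cmult_indicator) auto
    finally show ?thesis
      by (simp add: mult_ac)
  qed
  have slice: "(\<integral>\<^sup>+ t. h t x \<partial>lborel) = ennreal (\<bar>f x\<bar> powr p / p)" for x
  proof -
    \<comment> \<open>The slice of the region is the open interval from 0 to
      \<open>\<bar>f x\<bar>\<close>; the endpoints that the closed one adds are null.\<close>
    have "AE t in lborel. t \<noteq> 0 \<and> t \<noteq> \<bar>f x\<bar>"
      using AE_lborel_singleton[of 0] AE_lborel_singleton[of "\<bar>f x\<bar>"] by eventually_elim auto
    then have "(\<integral>\<^sup>+ t. h t x \<partial>lborel)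
        = (\<integral>\<^sup>+ t\<in>{0..\<bar>f x\<bar>}. ennreal (t powr (p - 1)) \<partial>lborel)"
      unfolding h_def by (intro nn_integral_cong_AE, eventually_elim) (auto simp: indicator_def)
    then show ?thesis
      using nn_integral_powr_from_0[OF \<open>0 < p\<close>] by simp
  qed
  have "tail_moment M f p = ennreal p * (\<integral>\<^sup>+ t. \<integral>\<^sup>+ x. h t x \<partial>M \<partial>lborel)"
    unfolding tail_moment_def by (simp add: tail)
  also have "\<dots> = ennreal p * (\<integral>\<^sup>+ x. ennreal (\<bar>f x\<bar> powr p / p) \<partial>M)"
    by (subst Fubini'[symmetric]) (simp_all add: slice)
  also have "\<dots> = (\<integral>\<^sup>+ x. ennreal p * ennreal (\<bar>f x\<bar> powr p / p) \<partial>M)"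
    by (subst nn_integral_cmult) auto
  also have "\<dots> = (\<integral>\<^sup>+ x. ennreal (\<bar>f x\<bar> powr p) \<partial>M)"
    using \<open>0 < p\<close> by (simp flip: ennreal_mult)
  finally show ?thesis ..
qed

text \<open>The set where \<open>f\<close> is nonzero is the countable union of the sets
  \<open>\<bar>f x\<bar> > 1 / Suc n\<close>, so these cannot all be null.\<close>

lemma tail_function_pos_if_not_AE_zero:
  assumes [measurable]: "f \<in> borel_measurable M" and "\<not> (AE x in M. f x = 0)"
  shows "\<exists>t>0. 0 < tail_function M f t"
proof (rule ccontr)
  assume "\<not> ?thesis"
  then have "tail_function M f t = 0" if "0 < t" for t
    using that by (metis not_gr_zero)
  then have "tail_function M f (1 / Suc n) = 0" for n
    by (simp del: of_nat_Suc)
  then have "AE x in M. \<bar>f x\<bar> \<le> 1 / Suc n" for n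
    unfolding tail_function_def by (subst AE_iff_measurable[OF _ refl]) (auto simp: not_le)
  then have "AE x in M. \<forall>n. \<bar>f x\<bar> \<le> 1 / Suc n"
    unfolding AE_all_countable by blast
  then have "AE x in M. f x = 0"
  proof eventually_elim
    case (elim x)
    show ?case
    proof (rule ccontr)
      assume "f x \<noteq> 0"
      then obtain n where "1 / Suc n < \<bar>f x\<bar>"
        using nat_approx_posE[of "\<bar>f x\<bar>"] by auto
      with elim[rule_format, of n] show False
        by simp
    qed
  qed
  with assms(2) show False ..
qed

text \<open>Markov's inequality for \<open>\<bar>f\<bar> powr p\<close>, in product form so that an
  infinite tail is allowed.\<close>

lemma powr_mult_tail_function_le:
  assumes [measurable]: "f \<in> borel_measurable M" and "0 < p" and "0 < t"
  shows "ennreal (t powr p) * tail_function M f t \<le> (\<integral>\<^sup>+ x. ennreal (\<bar>f x\<bar> powr p) \<partial>M)"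
proof -
  have "ennreal (t powr p) * tail_function M f t
      = (\<integral>\<^sup>+ x. ennreal (t powr p) * indicator {x \<in> space M. \<bar>f x\<bar> > t} x \<partial>M)"
    unfolding tail_function_def by (subst nn_integral_cmult_indicator) auto
  also have "\<dots> \<le> (\<integral>\<^sup>+ x. ennreal (\<bar>f x\<bar> powr p) \<partial>M)"
    using assms
    by (intro nn_integral_mono) (auto simp: indicator_def intro!: ennreal_leI powr_mono2)
  finally show ?thesis .
qed

text \<open>Markov's inequality at one fixed level \<open>t\<close> serves all exponents at once, so
  \<open>c\<close> does not depend on \<open>p\<close>.\<close>

lemma lp_norm_bounded_below:
  assumes "f \<in> borel_measurable M" and "\<not> (AE x in M. f x = 0)" and "0 < a"
  shows "\<exists>c>0. \<forall>p\<ge>a. ennreal c \<le> lp_norm M p f"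
proof -
  obtain t where t: "0 < t" "0 < tail_function M f t"
    using tail_function_pos_if_not_AE_zero[OF assms(1,2)] by blast
  \<comment> \<open>Truncated at 1 so that \<open>m powr (1 / p)\<close> increases with \<open>p\<close>.\<close>
  define m where "m = enn2real (min 1 (tail_function M f t))"
  \<comment> \<open>The truncation also makes the value finite when the tail is infinite, so passing
    to a real number loses nothing.\<close>
  have m_eq: "ennreal m = min 1 (tail_function M f t)"
    unfolding m_def by (rule ennreal_enn2real) (simp add: min_less_iff_disj)
  have m: "0 < m" "m \<le> 1"
  proof -
    have "0 < ennreal m" "ennreal m \<le> 1"
      unfolding m_eq using t by auto
    then show "0 < m" "m \<le> 1"
      by simp_all
  qed
  have "ennreal (t * m powr (1 / a)) \<le> lp_norm M p f" if "a \<le> p" for p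
  proof -
    have p: "0 < p"
      using that \<open>0 < a\<close> by simp
    have "ennreal (t powr p * m) = ennreal (t powr p) * ennreal m"
      using m by (simp add: ennreal_mult)
    also have "\<dots> \<le> ennreal (t powr p) * tail_function M f t"
      unfolding m_eq by (intro mult_left_mono) auto
    also have "\<dots> \<le> (\<integral>\<^sup>+ x. ennreal (\<bar>f x\<bar> powr p) \<partial>M)"
      by (rule powr_mult_tail_function_le) (use assms p t in auto)
    finally have "ennreal_powr (ennreal (t powr p * m)) (1 / p) \<le> lp_norm M p f"
      unfolding lp_norm_def by (rule ennreal_powr_mono) (use p in simp)
    also have "ennreal_powr (ennreal (t powr p * m)) (1 / p) = ennreal (t * m powr (1 / p))"
      using m t p by (simp add: ennreal_powr_ennreal powr_mult powr_powr)
    finally have "ennreal (t * m powr (1 / p)) \<le> lp_norm M p f" .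
    moreover have "m powr (1 / a) \<le> m powr (1 / p)"
      using m that \<open>0 < a\<close> by (intro powr_mono') (auto simp: field_simps)
    ultimately show ?thesis
      using t by (meson ennreal_leI less_imp_le mult_left_mono order_trans)
  qed
  moreover have "0 < t * m powr (1 / a)"
    using t m by simp
  ultimately show ?thesis
    by blast
qed

theorem proposition3p1:
  fixes M :: "'a measure" and f :: "'a \<Rightarrow> real" and a b :: ereal
  assumes "sigma_finite_measure M"
    and "emeasure M (space M) = \<infinity>"
    and "f \<in> borel_measurable M"
    and "\<not> (AE x in M. f x = 0)"
    and "0 < a" and "a < b" and "b \<le> \<infinity>"
    and "\<forall>p\<in>einterval a b. tail_moment M f p < \<infinity>"
  shows "generating_function a b (natural_generating_function M f) \<and>
         (\<forall>p\<in>einterval a b.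
            natural_generating_function M f p = ennreal_powr (tail_moment M f p) (1 / p)) \<and>
         f \<in> gls_space M a b (natural_generating_function M f) \<and>
         gls_norm M a b (natural_generating_function M f) f = 1"
proof -
  let ?\<psi> = "natural_generating_function M f"
  obtain r where r: "a = ereal r"
    using \<open>0 < a\<close> \<open>a < b\<close> by (cases a) auto
  have r_le: "r \<le> p" and p_pos: "0 < p" if "p \<in> einterval a b" for p
    using that \<open>0 < a\<close> unfolding r einterval_def by auto
  \<comment> \<open>Over an empty interval the supremum defining the norm would be 0 instead of
    1.\<close>
  have nonempty: "einterval a b \<noteq> {}"
    using ereal_dense2[OF \<open>a < b\<close>] by (auto simp: einterval_def)
  obtain c where c: "0 < c" "\<And>p. r \<le> p \<Longrightarrow> ennreal c \<le> lp_norm M p f"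
    using lp_norm_bounded_below[OF assms(3,4), of r] \<open>0 < a\<close> unfolding r by auto
  have form: "?\<psi> p = ennreal_powr (tail_moment M f p) (1 / p)" if "p \<in> einterval a b" for p
    using nn_integral_powr_eq_tail_moment[OF assms(1,3) p_pos[OF that]]
    by (simp add: natural_generating_function_def lp_norm_def)
  have fin: "?\<psi> p < \<infinity>" if "p \<in> einterval a b" for p
    unfolding form[OF that] using assms(8) that by (blast intro: ennreal_powr_less_top)
  have lower: "ennreal c \<le> ?\<psi> p" if "p \<in> einterval a b" for p
    using c(2)[OF r_le[OF that]] by (simp add: natural_generating_function_def)
  have "0 < ennreal c"
    using c(1) by simp
  then have pos: "0 < ?\<psi> p" if "p \<in> einterval a b" for p
    using lower[OF that] by (rule order.strict_trans2)
  \<comment> \<open>Pointwise positivity would not survive the infimum; the uniform bound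
    \<open>c\<close> does.\<close>
  have "ennreal c \<le> (INF p\<in>einterval a b. ?\<psi> p)"
    by (intro INF_greatest lower)
  with \<open>0 < ennreal c\<close> have "0 < (INF p\<in>einterval a b. ?\<psi> p)"
    by (rule order.strict_trans2)
  with fin pos have gen: "generating_function a b ?\<psi>"
    by (simp add: generating_function_def)
  \<comment> \<open>In \<open>ennreal\<close> both 0 / 0 and infinity / infinity are 0, hence the
    appeal to \<open>pos\<close> and \<open>fin\<close>.\<close>
  have "lp_norm M p f / ?\<psi> p = 1" if "p \<in> einterval a b" for p
    using fin[OF that] pos[OF that] unfolding natural_generating_function_def
    by (intro ennreal_divide_self) auto
  then have norm: "gls_norm M a b ?\<psi> f = 1"
    using nonempty by (simp add: gls_norm_def cong: SUP_cong)
  then have "f \<in> gls_space M a b ?\<psi>"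
    using assms(3) by (simp add: gls_space_def)
  with gen form norm show ?thesis
    by blast
qed

end
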